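(* Let $(X_t)_{t\ge0}$ be a regular non-explosive birth–death process on $\mathbb{N}$ with birth rates $(\lambda_x)_{x\in\mathbb{N}}$, death rates $(\nu_x)_{x\in\mathbb{N}}$, and stationary distribution $\pi\in\mathscr{P}_1(\mathbb{N})$. Assume that the rates $\lambda$ and $\nu$ are bounded on $\mathbb{N}$ and that there exists $K\le0$ such that $\inf_{x\in\mathbb{N}\setminus\{0\}}(\lambda_{x-1}-\lambda_x+\nu_x-\nu_{x-1})\ge K$. If $f\in\mathrm{Lip}_d(\mathbb{N})$, then for any $x\in\mathbb{N}$, any $t>0$ and any $y>0$, $$\mathbb{P}_x\big(f(X_t)-\mathbb{E}_x[f(X_t)]\ge y\big)\le\exp\left(-\frac{y\,e^{tK}}{2\|f\|_{\mathrm{Lip}_d}}\log\left(1+\frac{yK}{\sinh(tK)\,\|\lambda+\nu\|_\infty\,\|f\|_{\mathrm{Lip}_d}}\right)\right).$$ If $K=0$, this inequality should be replaced by its limit as $K\to0$ (i.e. $K/\sinh(tK)$ is replaced by $1/t$).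
   Context: Here $\mathbb{N}=\{0,1,2,\dots\}$ with metric $d(x,y)=|x-y|$. The birth–death process has generator $\mathcal{L}f(x)=\lambda_x(f(x+1)-f(x))+\nu_x(f(x-1)-f(x))$, where the rates are positive except $\nu_0=0$. Regular means that the rates determine the process uniquely. $\mathbb{P}_x,\mathbb{E}_x$ refer to the process started at $x$. $\|\lambda+\nu\|_\infty=\sup_{x}(\lambda_x+\nu_x)$. $\mathrm{Lip}_d(\mathbb{N})$ is the space of $f:\mathbb{N}\to\mathbb{R}$ with $\|f\|_{\mathrm{Lip}_d}:=\sup_{x\ne y}|f(x)-f(y)|/|x-y|<+\infty$. $\mathscr{P}_1(\mathbb{N})$ is the set of probability measures on $\mathbb{N}$ with finite first moment. *)

theory Defs
  imports "HOL-Probability.Probability"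
begin

text \<open>At \<open>x = 0\<close> the truncated subtraction \<open>x - 1\<close> is harmless: the second summand vanishes
  (and \<open>nu 0 = 0\<close> for birth-death rates anyway).\<close>

definition bd_generator ::
  "(nat \<Rightarrow> real) \<Rightarrow> (nat \<Rightarrow> real) \<Rightarrow> (nat \<Rightarrow> real) \<Rightarrow> nat \<Rightarrow> real"
  where "bd_generator lam nu f x =
    lam x * (f (x + 1) - f x) + nu x * (f (x - 1) - f x)"

definition birth_death_rates :: "(nat \<Rightarrow> real) \<Rightarrow> (nat \<Rightarrow> real) \<Rightarrow> bool"
  where "birth_death_rates lam nu \<longleftrightarrow>
    (\<forall>x. lam x > 0) \<and> nu 0 = 0 \<and> (\<forall>x>0. nu x > 0)"

text \<open>Standard transition functions on the natural numbers; as usual in the theory of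
  continuous-time chains, loss of mass is allowed.  Values at negative times are irrelevant.\<close>

definition transition_function :: "(real \<Rightarrow> nat \<Rightarrow> nat \<Rightarrow> real) \<Rightarrow> bool"
  where "transition_function p \<longleftrightarrow>
    (\<forall>t\<ge>0. \<forall>x y. 0 \<le> p t x y) \<and>
    (\<forall>t\<ge>0. \<forall>x. summable (p t x) \<and> (\<Sum>y. p t x y) \<le> 1) \<and>
    (\<forall>x y. p 0 x y = of_bool (x = y)) \<and>
    (\<forall>s\<ge>0. \<forall>t\<ge>0. \<forall>x y. (\<lambda>z. p s x z * p t z y) sums p (s + t) x y) \<and>
    (\<forall>x y. ((\<lambda>t. p t x y) \<longlongrightarrow> of_bool (x = y)) (at_right 0))"

text \<open>The generator is prescribed on finitely supported functions.  By linearity this says that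
  the derivative of \<open>p\<close> at time \<open>0\<close> is the (tridiagonal) matrix of rates.\<close>

definition has_bd_generator ::
  "(real \<Rightarrow> nat \<Rightarrow> nat \<Rightarrow> real) \<Rightarrow> (nat \<Rightarrow> real) \<Rightarrow> (nat \<Rightarrow> real) \<Rightarrow> bool"
  where "has_bd_generator p lam nu \<longleftrightarrow>
    (\<forall>f x. finite {y. f y \<noteq> 0} \<longrightarrow>
      ((\<lambda>t. ((\<Sum>y. p t x y * f y) - f x) / t) \<longlongrightarrow> bd_generator lam nu f x) (at_right 0))"

definition regular_rates :: "(nat \<Rightarrow> real) \<Rightarrow> (nat \<Rightarrow> real) \<Rightarrow> bool"
  where "regular_rates lam nu \<longleftrightarrow>
    (\<forall>p p'. transition_function p \<and> has_bd_generator p lam nu \<and>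
            transition_function p' \<and> has_bd_generator p' lam nu \<longrightarrow>
       (\<forall>t\<ge>0. \<forall>x y. p t x y = p' t x y))"

text \<open>\<open>P x\<close> is the law of the process started at \<open>x\<close>; all these laws live on the same
  measurable space.  Only times \<open>t \<ge> 0\<close> are relevant.\<close>

definition transition_prob ::
  "(nat \<Rightarrow> 'w measure) \<Rightarrow> (real \<Rightarrow> 'w \<Rightarrow> nat) \<Rightarrow> real \<Rightarrow> nat \<Rightarrow> nat \<Rightarrow> real"
  where "transition_prob P X t x y = measure (P x) {w \<in> space (P x). X t w = y}"

text \<open>The events generated by \<open>X u\<close> for \<open>0 \<le> u \<le> s\<close>, on the sample space \<open>W\<close>.\<close>

definition past_events :: "'w set \<Rightarrow> (real \<Rightarrow> 'w \<Rightarrow> nat) \<Rightarrow> real \<Rightarrow> 'w set set"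
  where "past_events W X s =
    sigma_sets W {X u -` B \<inter> W | u B. 0 \<le> u \<and> u \<le> s}"

locale markov_process =
  fixes P :: "nat \<Rightarrow> 'w measure"
    and X :: "real \<Rightarrow> 'w \<Rightarrow> nat"
  assumes prob_space_P: "prob_space (P x)"
    and sets_P: "sets (P x) = sets (P x')"
    and measurable_X: "t \<ge> 0 \<Longrightarrow> X t \<in> measurable (P x) (count_space UNIV)"
    and start: "AE w in P x. X 0 w = x"
    and right_continuous:
      "AE w in P x. \<forall>t\<ge>0. eventually (\<lambda>s. X s w = X t w) (at_right t)"
    and markov_property:
      "\<lbrakk>s \<ge> 0; t \<ge> 0; A \<in> past_events (space (P x)) X s\<rbrakk> \<Longrightarrow>
        measure (P x) (A \<inter> {w \<in> space (P x). X s w = y \<and> X (s + t) w = z}) =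
        measure (P x) (A \<inter> {w \<in> space (P x). X s w = y}) * transition_prob P X t y z"

locale birth_death_process = markov_process P X
  for P :: "nat \<Rightarrow> 'w measure" and X :: "real \<Rightarrow> 'w \<Rightarrow> nat" +
  fixes lam nu :: "nat \<Rightarrow> real"
  assumes rates: "birth_death_rates lam nu"
    and generator: "has_bd_generator (transition_prob P X) lam nu"

text \<open>For a right-continuous path, the jump times are the times at which the path is not locally
  constant from the left.  Non-explosion: finitely many jumps in bounded time.\<close>

definition nonexplosive :: "(nat \<Rightarrow> 'w measure) \<Rightarrow> (real \<Rightarrow> 'w \<Rightarrow> nat) \<Rightarrow> bool"
  where "nonexplosive P X \<longleftrightarrow>
    (\<forall>x. AE w in P x. \<forall>T>0.
      finite {t \<in> {0<..T}. \<not> eventually (\<lambda>s. X s w = X t w) (at_left t)})"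

definition stationary_distribution ::
  "(nat \<Rightarrow> 'w measure) \<Rightarrow> (real \<Rightarrow> 'w \<Rightarrow> nat) \<Rightarrow> nat pmf \<Rightarrow> bool"
  where "stationary_distribution P X \<pi> \<longleftrightarrow>
    (\<forall>t\<ge>0. \<forall>y. (\<lambda>x. pmf \<pi> x * transition_prob P X t x y) sums pmf \<pi> y)"

definition finite_first_moment :: "nat pmf \<Rightarrow> bool"
  where "finite_first_moment \<pi> \<longleftrightarrow> integrable (measure_pmf \<pi>) real"

text \<open>On \<open>nat\<close>, the library metric is \<open>dist x y = \<bar>real x - real y\<bar>\<close>.\<close>

definition lip_quotients :: "(nat \<Rightarrow> real) \<Rightarrow> real set"
  where "lip_quotients f = {\<bar>f x - f y\<bar> / dist x y | x y. x \<noteq> y}"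

definition is_Lip :: "(nat \<Rightarrow> real) \<Rightarrow> bool"
  where "is_Lip f \<longleftrightarrow> bdd_above (lip_quotients f)"

definition Lip_norm :: "(nat \<Rightarrow> real) \<Rightarrow> real"
  where "Lip_norm f = Sup (lip_quotients f)"

definition rate_sup_norm :: "(nat \<Rightarrow> real) \<Rightarrow> (nat \<Rightarrow> real) \<Rightarrow> real"
  where "rate_sup_norm lam nu = (SUP x. lam x + nu x)"

text \<open>\<open>K / sinh (t K)\<close>, continued by its limit \<open>1 / t\<close> at \<open>K = 0\<close>.\<close>

definition sinh_ratio :: "real \<Rightarrow> real \<Rightarrow> real"
  where "sinh_ratio K t = (if K = 0 then 1 / t else K / sinh (t * K))"

text \<open>The upper bound for the deviation probability, with \<open>C\<close> the supremum of the total rates and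
  \<open>L\<close> the Lipschitz seminorm.  For constant functions (\<open>L = 0\<close>) the formula is read as its limit
  \<open>0\<close>, because in HOL division by zero would turn it into the trivial bound \<open>1\<close>.\<close>

definition deviation_bound :: "real \<Rightarrow> real \<Rightarrow> real \<Rightarrow> real \<Rightarrow> real \<Rightarrow> real"
  where "deviation_bound K C L t y =
    (if L = 0 then 0
     else exp (- (y * exp (t * K) / (2 * L)) * ln (1 + y * sinh_ratio K t / (C * L))))"

end

theory Submission
  imports Defs
begin

text \<open>The semigroup is approximated by the iterates of the Euler steps \<open>S = I + (t/n) L\<close>.
  Submultiplicativity of the transition function bounds \<open>p h x x\<close>, \<open>p h x (x + 1)\<close> and
  \<open>p h x (x - 1)\<close> from below by the entries of \<open>I + h L\<close> up to an error of order \<open>h\<^sup>2\<close>, uniformly in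
  \<open>x\<close>; since both kernels have mass one, they then differ by \<open>O(h\<^sup>2)\<close> in total variation, and
  \<open>S ^ n\<close> converges to \<open>P\<^sub>t\<close>.

  The curvature condition gives \<open>Lip (S u) \<le> exp (- K h) Lip u\<close>.  Moreover
  \<open>S (exp \<circ> u) \<le> exp (S u + h C \<psi>(Lip u))\<close> with \<open>\<psi> z = exp z - 1 - z\<close>.  Iterating this with
  \<open>u = \<tau> f\<close>, and using \<open>\<psi> (a b) \<le> a\<^sup>2 \<psi> b\<close> for \<open>a \<le> 1\<close> to compare all Lipschitz constants with the
  largest one, \<open>M = Lip f exp (- K t)\<close>, bounds the logarithmic moment generating function of
  \<open>f (X\<^sub>t)\<close>, centred, by \<open>V \<psi>(\<tau> M)\<close> with \<open>V = C exp (K t) sinh (K t) / K\<close>.  The Chernoff bound with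
  \<open>\<tau> M = ln (1 + y / (V M))\<close> and \<open>ln (1 + r) \<ge> 2 r / (2 + r)\<close> finishes the proof.\<close>

subsection \<open>Elementary inequalities\<close>

text \<open>Compare the power series term by term: all exponents are at least 2, so
  \<open>a ^ (n + 2) \<le> a\<^sup>2\<close>.\<close>

lemma exp_minus_one_minus_scale:
  fixes a b z :: real
  assumes a: "0 \<le> a" "a \<le> 1" and b: "0 \<le> b" and z: "\<bar>z\<bar> \<le> a * b"
  shows "exp z - 1 - z \<le> a\<^sup>2 * (exp b - 1 - b)"
proof -
  have *: "(\<lambda>n. x ^ (n + 2) / fact (n + 2)) sums (exp x - 1 - x)" for x :: real
  proof -
    have "(\<lambda>n. x ^ n /\<^sub>R fact n) sums exp x"
      by (rule exp_converges)
    from sums_split_initial_segment[OF this, of 2] show ?thesis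
      by (simp add: numeral_2_eq_2 field_simps scaleR_conv_of_real)
  qed
  have "z ^ (n + 2) \<le> a\<^sup>2 * b ^ (n + 2)" for n
  proof -
    have "z ^ (n + 2) \<le> \<bar>z\<bar> ^ (n + 2)"
      by (metis abs_ge_self power_abs)
    also have "\<dots> \<le> (a * b) ^ (n + 2)"
      by (rule power_mono[OF z]) simp
    also have "\<dots> = a ^ (n + 2) * b ^ (n + 2)"
      by (rule power_mult_distrib)
    also have "\<dots> \<le> a\<^sup>2 * b ^ (n + 2)"
      by (rule mult_right_mono[OF power_decreasing]) (use a b in auto)
    finally show ?thesis .
  qed
  then have "z ^ (n + 2) / fact (n + 2) \<le> a\<^sup>2 * (b ^ (n + 2) / fact (n + 2))" for n
    by (metis divide_right_mono fact_ge_zero times_divide_eq_right)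
  from sums_le[OF this * sums_mult[OF *]] show ?thesis .
qed

text \<open>\<open>ln (1 + r) / M\<close> minimises
  \<open>- \<tau> * y + V * (exp (\<tau> * M) - 1 - \<tau> * M)\<close> over \<open>\<tau>\<close>:
  at the critical point \<open>exp (\<tau> * M) = 1 + y / (V * M)\<close>. The minimum is
  \<open>- V * ((1 + r) * ln (1 + r) - r)\<close>.\<close>

lemma optimal_exponent_bound:
  fixes V M y r :: real
  assumes "M > 0" "y > 0" "r > 0" "y = V * M * r"
  shows "- (ln (1 + r) / M) * y + V * (exp (ln (1 + r)) - 1 - ln (1 + r))
    \<le> - (y / (2 * M)) * ln (1 + r)"
proof -
  have V: "V > 0"
    using assms by (metis zero_less_mult_pos2)
  have "2 * r / (2 + r) \<le> ln (1 + r)"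
    using ln_inverse_approx_ge[of 1 "1 + r"] assms by simp
  then have "2 * r \<le> ln (1 + r) * (2 + r)"
    using \<open>r > 0\<close> by (simp add: field_simps)
  then have "V * (2 * r) \<le> V * (ln (1 + r) * (2 + r))"
    using V by (intro mult_left_mono) auto
  then show ?thesis
    using assms by (simp add: field_simps)
qed

lemma sinh_ratio_pos: "t > 0 \<Longrightarrow> sinh_ratio K t > 0"
  by (cases K "0 :: real" rule: linorder_cases)
    (auto simp: sinh_ratio_def divide_simps mult_less_0_iff zero_less_mult_iff)

text \<open>A lower Riemann sum for the integral of \<open>exp (2 * K * (t - s))\<close> over
  \<open>0 \<le> s \<le> t\<close>, whose value is \<open>exp (t * K) * sinh (t * K) / K\<close>, or
  \<open>t\<close> if \<open>K = 0\<close>.\<close>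

lemma riemann_sum_exp_le:
  fixes K t h :: real and n :: nat
  assumes K: "K \<le> 0" and h: "h * real n = t" "t > 0"
  shows "h * (\<Sum>k<n. (exp (K * (t - h * real k)))\<^sup>2) \<le> exp (t * K) / sinh_ratio K t"
proof (cases "K = 0")
  case True
  then show ?thesis using h by (simp add: sinh_ratio_def)
next
  case False
  then have K: "K < 0" using assms by simp
  \<comment> \<open>An antiderivative of the integrand at the grid points;
    \<open>1 + z \<le> exp z\<close> bounds each summand by an increment of
    \<open>F\<close>.\<close>
  define F where "F k = exp (2 * K * (t - h * real k)) / (- 2 * K)" for k :: nat
  have "h * (exp (K * (t - h * real k)))\<^sup>2 \<le> F (Suc k) - F k" for k
  proof -
    have e: "F (Suc k) = exp (2 * K * (t - h * real k)) * exp (- 2 * K * h) / (- 2 * K)"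
      by (simp add: F_def exp_add[symmetric] algebra_simps)
    have e2: "(exp (K * (t - h * real k)))\<^sup>2 = exp (2 * K * (t - h * real k))"
      by (simp add: power2_eq_square exp_add[symmetric] algebra_simps)
    have "exp (2 * K * (t - h * real k)) * (- 2 * K * h)
        \<le> exp (2 * K * (t - h * real k)) * (exp (- 2 * K * h) - 1)"
      using exp_ge_add_one_self[of "- 2 * K * h"] by (intro mult_left_mono) (auto simp: algebra_simps)
    then have "exp (2 * K * (t - h * real k)) * h
        \<le> exp (2 * K * (t - h * real k)) * (exp (- 2 * K * h) - 1) / (- 2 * K)"
      using K by (subst pos_le_divide_eq) (auto simp: algebra_simps)
    then show ?thesis
      unfolding e e2 by (simp add: F_def algebra_simps diff_divide_distrib add_divide_distrib)
  qed
  then have "(\<Sum>k<n. h * (exp (K * (t - h * real k)))\<^sup>2) \<le> (\<Sum>k<n. F (Suc k) - F k)"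
    by (intro sum_mono) auto
  also have "\<dots> = F n - F 0"
    by (rule sum_lessThan_telescope)
  also have "\<dots> = exp (t * K) / sinh_ratio K t"
  proof -
    have "exp (t * K) * sinh (t * K) = (exp (2 * K * t) - 1) / 2"
      by (simp add: sinh_def field_simps exp_add[symmetric] exp_minus)
    moreover have "F n - F 0 = (exp (2 * K * t) - 1) / (2 * K)"
      using K h by (simp add: F_def field_simps)
    ultimately show ?thesis
      using K by (simp add: sinh_ratio_def field_simps)
  qed
  finally show ?thesis by (simp add: sum_distrib_left)
qed

lemma abs_le_of_increments_le:
  fixes f :: "nat \<Rightarrow> real"
  assumes "\<And>x. \<bar>f (x + 1) - f x\<bar> \<le> L"
  shows "\<bar>f w\<bar> \<le> \<bar>f 0\<bar> + L * real w"
proof (induction w)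
  case (Suc w)
  then show ?case using assms[of w] by (simp add: algebra_simps)
qed simp

subsection \<open>The Euler step of the generator\<close>

text \<open>For \<open>h\<close> times the total rate at most \<open>1\<close> this is the transition operator of a nearest-neighbour
  Markov chain, so its iterates involve only finite sums, also for unbounded functions.\<close>

definition bd_step :: "(nat \<Rightarrow> real) \<Rightarrow> (nat \<Rightarrow> real) \<Rightarrow> real \<Rightarrow> (nat \<Rightarrow> real) \<Rightarrow> nat \<Rightarrow> real"
  where "bd_step lam nu h u x = u x + h * bd_generator lam nu u x"

section \<open>Linearity and finite propagation of the Euler steps\<close>

lemma bd_step_eq:
  "bd_step lam nu h u x =
    (1 - h * (lam x + nu x)) * u x + h * lam x * u (x + 1) + h * nu x * u (x - 1)"
  by (simp add: bd_step_def bd_generator_def algebra_simps)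

lemma bd_step_diff:
  "bd_step lam nu h (\<lambda>z. u z - v z) x = bd_step lam nu h u x - bd_step lam nu h v x"
  by (simp add: bd_step_eq algebra_simps)

lemma bd_step_scale: "bd_step lam nu h (\<lambda>z. c * u z) = (\<lambda>x. c * bd_step lam nu h u x)"
  by (rule ext) (simp add: bd_step_eq algebra_simps)

lemma bd_step_funpow_scale:
  "(bd_step lam nu h ^^ n) (\<lambda>z. c * u z) = (\<lambda>x. c * (bd_step lam nu h ^^ n) u x)"
  by (induction n) (simp_all add: bd_step_scale)

lemma bd_step_const: "bd_step lam nu h (\<lambda>_. c) x = c"
  by (simp add: bd_step_def bd_generator_def)

text \<open>The kernel of an iterate is its action on indicators. In \<open>n\<close>
  nearest-neighbour steps the chain stays in \<open>{..x + n}\<close>, so the sum is finite for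
  every \<open>g\<close>.\<close>

lemma bd_step_funpow_eq_sum:
  "x + n \<le> N \<Longrightarrow> (bd_step lam nu h ^^ n) g x =
    (\<Sum>w\<le>N. g w * (bd_step lam nu h ^^ n) (\<lambda>z. of_bool (z = w)) x)"
proof (induction n arbitrary: x)
  case 0
  have "(\<Sum>w\<le>N. g w * of_bool (x = w)) = (\<Sum>w\<in>{x}. g w * of_bool (x = w))"
    using 0 by (intro sum.mono_neutral_right) auto
  then show ?case by simp
next
  case (Suc n)
  have x: "x + n \<le> N" "(x + 1) + n \<le> N" "(x - 1) + n \<le> N"
    using Suc.prems by auto
  note IH = Suc.IH[OF x(1)] Suc.IH[OF x(2)] Suc.IH[OF x(3)]
  show ?case
    unfolding funpow.simps o_apply bd_step_eq[of lam nu h "(bd_step lam nu h ^^ n) v" for v]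
      IH sum_distrib_left sum.distrib[symmetric]
    by (intro sum.cong refl) (simp add: algebra_simps)
qed

lemma bd_step_funpow_sums:
  "(\<lambda>w. g w * (bd_step lam nu h ^^ n) (\<lambda>z. of_bool (z = w)) x) sums (bd_step lam nu h ^^ n) g x"
proof -
  \<comment> \<open>The sum formula is applied to the indicator of \<open>w\<close> itself, which
    vanishes on the whole range of summation.\<close>
  have "(bd_step lam nu h ^^ n) (\<lambda>z. of_bool (z = w)) x = 0" if "w \<notin> {..x + n}" for w
    using that by (subst bd_step_funpow_eq_sum[of _ _ "x + n"]) (auto intro!: sum.neutral)
  then show ?thesis
    by (subst bd_step_funpow_eq_sum[OF order_refl]) (intro sums_finite, auto)
qed

section \<open>Monotonicity, tails, exponential moments and Lipschitz constants for bounded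
  rates\<close>

locale bounded_bd_rates =
  fixes lam nu :: "nat \<Rightarrow> real" and C :: real
  assumes lam_nonneg: "0 \<le> lam x" and nu_nonneg: "0 \<le> nu x" and rates_le: "lam x + nu x \<le> C"
begin

lemma C_nonneg: "0 \<le> C"
  using lam_nonneg[of 0] nu_nonneg[of 0] rates_le[of 0] by linarith

lemma bd_step_mono:
  assumes h: "0 \<le> h" "h * C \<le> 1" and uv: "\<And>x. u x \<le> v x"
  shows "bd_step lam nu h u x \<le> bd_step lam nu h v x"
proof -
  have "h * (lam x + nu x) \<le> h * C"
    by (rule mult_left_mono[OF rates_le h(1)])
  then have "0 \<le> 1 - h * (lam x + nu x)" using h by linarith
  then show ?thesis
    unfolding bd_step_eq
    by (intro add_mono mult_left_mono uv) (auto simp: h lam_nonneg nu_nonneg)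
qed

lemma bd_step_funpow_mono:
  assumes "0 \<le> h" "h * C \<le> 1" and "\<And>x. u x \<le> v x"
  shows "(bd_step lam nu h ^^ n) u x \<le> (bd_step lam nu h ^^ n) v x"
  using assms(3) by (induction n arbitrary: x) (auto intro!: bd_step_mono assms(1,2))

lemma bd_step_abs_le:
  assumes h: "0 \<le> h" "h * C \<le> 1" and u: "\<And>x. \<bar>u x\<bar> \<le> c"
  shows "\<bar>bd_step lam nu h u x\<bar> \<le> c"
proof -
  have "- c \<le> u z" "u z \<le> c" for z using u[of z] by linarith+
  then show ?thesis
    using bd_step_mono[OF h, of u "\<lambda>_. c" x] bd_step_mono[OF h, of "\<lambda>_. - c" u x]
    by (simp add: bd_step_const abs_le_iff)
qed

text \<open>\<open>2 ^ z\<close> is a Lyapunov function: an upward jump from \<open>x\<close> adds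
  \<open>2 ^ x\<close> and a downward jump never increases it, so the generator takes it to at most
  \<open>C\<close> times itself.\<close>

lemma bd_step_funpow_power2_le:
  assumes h: "0 \<le> h" "h * C \<le> 1"
  shows "(bd_step lam nu h ^^ n) (\<lambda>z. 2 ^ z) x \<le> exp (real n * h * C) * 2 ^ x"
proof (induction n arbitrary: x)
  case (Suc n)
  have "bd_step lam nu h (\<lambda>z. 2 ^ z) x \<le> exp (h * C) * 2 ^ x"
  proof -
    have "bd_generator lam nu (\<lambda>z. 2 ^ z) x \<le> lam x * 2 ^ x"
      using nu_nonneg[of x] by (simp add: bd_generator_def mult_le_0_iff power_increasing)
    also have "\<dots> \<le> C * 2 ^ x"
      using rates_le[of x] nu_nonneg[of x] by (intro mult_right_mono) auto
    finally have "bd_step lam nu h (\<lambda>z. 2 ^ z) x \<le> 2 ^ x + h * (C * 2 ^ x)"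
      unfolding bd_step_def using h by (intro add_left_mono mult_left_mono) auto
    also have "\<dots> = (1 + h * C) * 2 ^ x" by (simp add: algebra_simps)
    also have "\<dots> \<le> exp (h * C) * 2 ^ x"
      by (intro mult_right_mono exp_ge_add_one_self) auto
    finally show ?thesis .
  qed
  then have "exp (real n * h * C) * bd_step lam nu h (\<lambda>z. 2 ^ z) x
      \<le> exp (real n * h * C) * (exp (h * C) * 2 ^ x)"
    by (intro mult_left_mono) auto
  moreover have "bd_step lam nu h ((bd_step lam nu h ^^ n) (\<lambda>z. 2 ^ z)) x
      \<le> bd_step lam nu h (\<lambda>z. exp (real n * h * C) * 2 ^ z) x"
    by (intro bd_step_mono h Suc.IH)
  moreover have "exp (real (Suc n) * h * C) = exp (real n * h * C) * exp (h * C)"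
    by (simp add: exp_add[symmetric] algebra_simps)
  ultimately show ?case
    unfolding funpow.simps o_apply bd_step_scale by (simp only: mult.assoc)
qed simp

text \<open>The upper bound is Markov's inequality for \<open>2 ^ z\<close>. For fixed
  \<open>n * h\<close> it gives geometric tails in \<open>w\<close> uniformly in \<open>n\<close>,
  as dominated convergence requires.\<close>

lemma bd_step_funpow_indicator_bounds:
  assumes h: "0 \<le> h" "h * C \<le> 1"
  shows "0 \<le> (bd_step lam nu h ^^ n) (\<lambda>z. of_bool (z = w)) x"
    and "(bd_step lam nu h ^^ n) (\<lambda>z. of_bool (z = w)) x \<le> exp (real n * h * C) * 2 ^ x / 2 ^ w"
proof -
  have "(bd_step lam nu h ^^ n) (\<lambda>_. 0) x = 0" for n
    using bd_step_funpow_scale[where c = 0] by simp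
  then show "0 \<le> (bd_step lam nu h ^^ n) (\<lambda>z. of_bool (z = w)) x"
    using bd_step_funpow_mono[OF h, of "\<lambda>_. 0" "\<lambda>z. of_bool (z = w)" n x] by simp
  have "2 ^ w * (bd_step lam nu h ^^ n) (\<lambda>z. of_bool (z = w)) x
      = (bd_step lam nu h ^^ n) (\<lambda>z. 2 ^ w * of_bool (z = w)) x"
    by (simp only: bd_step_funpow_scale)
  also have "\<dots> \<le> (bd_step lam nu h ^^ n) (\<lambda>z. 2 ^ z) x"
    by (intro bd_step_funpow_mono h) auto
  also have "\<dots> \<le> exp (real n * h * C) * 2 ^ x"
    by (rule bd_step_funpow_power2_le[OF h])
  finally show "(bd_step lam nu h ^^ n) (\<lambda>z. of_bool (z = w)) x \<le> exp (real n * h * C) * 2 ^ x / 2 ^ w"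
    by (simp add: field_simps)
qed

text \<open>An increment \<open>z\<close> of \<open>u\<close> enters the generator as
  \<open>exp z - 1\<close>, which is at most \<open>z + D\<close>. The linear parts rebuild the
  generator of \<open>u\<close>, the errors cost at most \<open>C * D\<close>, and
  \<open>1 + z \<le> exp z\<close> restores an exponential.\<close>

lemma bd_step_exp_le:
  assumes h: "0 \<le> h" and a: "0 \<le> a" "a \<le> 1" and b: "0 \<le> b"
    and u: "\<And>x. \<bar>u (x + 1) - u x\<bar> \<le> a * b"
  shows "bd_step lam nu h (\<lambda>z. exp (u z)) x
    \<le> exp (bd_step lam nu h u x + h * C * (a\<^sup>2 * (exp b - 1 - b)))"
proof -
  define D where "D = a\<^sup>2 * (exp b - 1 - b)"
  have D: "exp z - 1 - z \<le> D" if "\<bar>z\<bar> \<le> a * b" for z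
    unfolding D_def by (rule exp_minus_one_minus_scale) (use a b that in auto)
  have D0: "0 \<le> D" using D[of 0] a b by simp
  \<comment> \<open>At \<open>x = 0\<close> truncated subtraction makes this increment zero.\<close>
  have *: "\<bar>u (x - 1) - u x\<bar> \<le> a * b"
    using u[of "x - 1"] a b by (cases x) (auto simp: abs_minus_commute)
  have e: "exp (u z) - exp (u x) = exp (u x) * (exp (u z - u x) - 1)" for z
    by (simp add: exp_diff algebra_simps)
  have "bd_generator lam nu (\<lambda>z. exp (u z)) x
      = exp (u x) * (lam x * (exp (u (x + 1) - u x) - 1) + nu x * (exp (u (x - 1) - u x) - 1))"
    unfolding bd_generator_def e by (simp add: algebra_simps)
  also have "\<dots> \<le> exp (u x) * (lam x * (u (x + 1) - u x + D) + nu x * (u (x - 1) - u x + D))"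
    using D[OF u[of x]] D[OF *]
    by (intro mult_left_mono add_mono lam_nonneg nu_nonneg) auto
  also have "\<dots> = exp (u x) * (bd_generator lam nu u x + (lam x + nu x) * D)"
    by (simp add: bd_generator_def algebra_simps)
  also have "\<dots> \<le> exp (u x) * (bd_generator lam nu u x + C * D)"
    using D0 rates_le by (intro mult_left_mono add_left_mono mult_right_mono) auto
  finally have "bd_step lam nu h (\<lambda>z. exp (u z)) x
      \<le> exp (u x) + h * (exp (u x) * (bd_generator lam nu u x + C * D))"
    unfolding bd_step_def using h by (intro add_left_mono mult_left_mono)
  also have "\<dots> = exp (u x) * (1 + h * (bd_generator lam nu u x + C * D))"
    by (simp add: algebra_simps)
  also have "\<dots> \<le> exp (u x) * exp (h * (bd_generator lam nu u x + C * D))"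
    by (intro mult_left_mono exp_ge_add_one_self) auto
  also have "\<dots> = exp (bd_step lam nu h u x + h * C * D)"
    by (simp add: bd_step_def exp_add[symmetric] algebra_simps)
  finally show ?thesis by (simp add: D_def)
qed

text \<open>The new increment is a combination of the increments of \<open>u\<close> over three
  adjacent edges. The first weight involves the rates of two sites, so
  \<open>2 * h * C \<le> 1\<close> makes it nonnegative. The weights add up to one minus
  \<open>h\<close> times the curvature expression.\<close>

lemma bd_step_Lip:
  assumes h: "0 \<le> h" "2 * h * C \<le> 1" and K: "\<And>x. K \<le> lam x - lam (x + 1) + nu (x + 1) - nu x"
    and nu0: "nu 0 = 0" and u: "\<And>x. \<bar>u (x + 1) - u x\<bar> \<le> l"
  shows "\<bar>bd_step lam nu h u (x + 1) - bd_step lam nu h u x\<bar> \<le> exp (- K * h) * l"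
proof -
  have l: "0 \<le> l" using u[of 0] by linarith
  have "h * (lam x + nu (x + 1)) \<le> h * (2 * C)"
    using rates_le[of x] rates_le[of "x + 1"] nu_nonneg[of x] lam_nonneg[of "x + 1"] h
    by (intro mult_left_mono) auto
  then have c: "0 \<le> 1 - h * (nu (x + 1) + lam x)" using h by (simp add: algebra_simps)
  have u': "\<bar>h * nu x * (u x - u (x - 1))\<bar> \<le> h * nu x * l"
  proof (cases x)
    case 0
    then show ?thesis using nu0 by simp
  next
    case (Suc m)
    then show ?thesis
      using u[of m] h nu_nonneg[of x] by (simp add: abs_mult mult_left_mono)
  qed
  have "bd_step lam nu h u (x + 1) - bd_step lam nu h u x
     = (1 - h * (nu (x + 1) + lam x)) * (u (x + 1) - u x)
      + h * lam (x + 1) * (u (x + 1 + 1) - u (x + 1)) + h * nu x * (u x - u (x - 1))"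
    by (simp add: bd_step_eq algebra_simps)
  also have "\<bar>\<dots>\<bar> \<le> \<bar>(1 - h * (nu (x + 1) + lam x)) * (u (x + 1) - u x)\<bar>
      + \<bar>h * lam (x + 1) * (u (x + 1 + 1) - u (x + 1))\<bar> + \<bar>h * nu x * (u x - u (x - 1))\<bar>"
    by linarith
  also have "\<dots> \<le> (1 - h * (nu (x + 1) + lam x)) * l + h * lam (x + 1) * l + h * nu x * l"
  proof (intro add_mono u')
    show "\<bar>(1 - h * (nu (x + 1) + lam x)) * (u (x + 1) - u x)\<bar> \<le> (1 - h * (nu (x + 1) + lam x)) * l"
      unfolding abs_mult abs_of_nonneg[OF c] by (rule mult_left_mono[OF u c])
    have c': "0 \<le> h * lam (x + 1)" using h lam_nonneg by simp
    show "\<bar>h * lam (x + 1) * (u (x + 1 + 1) - u (x + 1))\<bar> \<le> h * lam (x + 1) * l"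
      unfolding abs_mult[of "h * lam (x + 1)"] abs_of_nonneg[OF c'] by (rule mult_left_mono[OF u c'])
  qed
  also have "\<dots> = (1 + h * - (lam x - lam (x + 1) + nu (x + 1) - nu x)) * l"
    by (simp add: algebra_simps)
  also have "\<dots> \<le> (1 + h * - K) * l"
    using K[of x] h l by (intro mult_right_mono add_left_mono mult_left_mono) auto
  also have "\<dots> \<le> exp (- K * h) * l"
    using exp_ge_add_one_self[of "- K * h"] l by (intro mult_right_mono) (auto simp: algebra_simps)
  finally show ?thesis .
qed

lemma bd_step_funpow_Lip:
  assumes "0 \<le> h" "2 * h * C \<le> 1" "\<And>x. K \<le> lam x - lam (x + 1) + nu (x + 1) - nu x"
    and "nu 0 = 0" and "\<And>x. \<bar>u (x + 1) - u x\<bar> \<le> l"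
  shows "\<bar>(bd_step lam nu h ^^ n) u (x + 1) - (bd_step lam nu h ^^ n) u x\<bar> \<le> exp (- K * h * real n) * l"
proof (induction n arbitrary: x)
  case 0
  then show ?case using assms(5)[of x] by simp
next
  case (Suc n)
  show ?case
    using bd_step_Lip[of h K "(bd_step lam nu h ^^ n) u", OF assms(1-4) Suc.IH, of x]
    by (simp add: mult.assoc[symmetric] exp_add[symmetric] ring_distribs add.commute)
qed

text \<open>The Lipschitz constant after \<open>k\<close> steps is at most \<open>a * b\<close> with
  \<open>a = exp (K * (t - h * real k))\<close>. As \<open>b\<close> bounds the one after all
  \<open>n\<close> steps, \<open>a \<le> 1\<close> and step \<open>k\<close> costs at most
  \<open>h * C * a\<^sup>2 * (exp b - 1 - b)\<close>.\<close>

lemma bd_step_funpow_exp_le: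
  assumes h: "0 \<le> h" "2 * h * C \<le> 1" "h * real n = t"
    and K: "K \<le> 0" "\<And>x. K \<le> lam x - lam (x + 1) + nu (x + 1) - nu x"
    and nu0: "nu 0 = 0" and u: "\<And>x. \<bar>u (x + 1) - u x\<bar> \<le> exp (K * t) * b" and b: "0 \<le> b"
    and k: "k \<le> n"
  shows "(bd_step lam nu h ^^ k) (\<lambda>z. exp (u z)) x
    \<le> exp ((bd_step lam nu h ^^ k) u x
        + C * (h * (\<Sum>j<k. (exp (K * (t - h * real j)))\<^sup>2)) * (exp b - 1 - b))"
  using k
proof (induction k arbitrary: x)
  case (Suc k)
  let ?B = "C * (h * (\<Sum>j<k. (exp (K * (t - h * real j)))\<^sup>2)) * (exp b - 1 - b)"
  have hC: "h * C \<le> 1" using h mult_nonneg_nonneg[OF h(1) C_nonneg] by linarith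
  have "h * real k \<le> h * real n" using h Suc.prems by (intro mult_left_mono) auto
  then have a: "exp (K * (t - h * real k)) \<le> 1"
    using K h by (simp add: mult_nonpos_nonneg)
  have "(bd_step lam nu h ^^ Suc k) (\<lambda>z. exp (u z)) x
      \<le> bd_step lam nu h (\<lambda>z. exp ((bd_step lam nu h ^^ k) u z + ?B)) x"
    using Suc.IH Suc.prems by (auto intro!: bd_step_mono h hC)
  \<comment> \<open>The accumulated error does not depend on the state, so it becomes a factor that
    commutes with the linear step.\<close>
  also have "\<dots> = exp ?B * bd_step lam nu h (\<lambda>z. exp ((bd_step lam nu h ^^ k) u z)) x"
    by (simp only: exp_add mult.commute[of _ "exp ?B"] bd_step_scale)
  also have "\<dots> \<le> exp ?B * exp (bd_step lam nu h ((bd_step lam nu h ^^ k) u) x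
      + h * C * ((exp (K * (t - h * real k)))\<^sup>2 * (exp b - 1 - b)))"
  proof (intro mult_left_mono bd_step_exp_le h a b)
    show "\<bar>(bd_step lam nu h ^^ k) u (x + 1) - (bd_step lam nu h ^^ k) u x\<bar> \<le> exp (K * (t - h * real k)) * b" for x
      using bd_step_funpow_Lip[of h K u "exp (K * t) * b", OF h(1,2) K(2) nu0 u, of k x]
      by (simp add: mult.assoc[symmetric] exp_add[symmetric]) (simp add: algebra_simps)
  qed auto
  also have "\<dots> = exp ((bd_step lam nu h ^^ Suc k) u x
        + C * (h * (\<Sum>j<Suc k. (exp (K * (t - h * real j)))\<^sup>2)) * (exp b - 1 - b))"
    by (simp add: exp_add[symmetric] algebra_simps)
  finally show ?case .
qed simp

end

subsection \<open>Euler approximation of the semigroup\<close>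

text \<open>The derivative at zero is entrywise, with no uniformity in \<open>x\<close>; uniform
  estimates come from the semigroup law and the bound on the rates.\<close>

locale bounded_bd_semigroup = bounded_bd_rates lam nu C for lam nu C +
  fixes p :: "real \<Rightarrow> nat \<Rightarrow> nat \<Rightarrow> real"
  assumes nu_zero: "nu 0 = 0"
    and p_nonneg: "0 \<le> t \<Longrightarrow> 0 \<le> p t x y"
    and p_sums: "0 \<le> t \<Longrightarrow> p t x sums 1"
    and p_zero: "p 0 x y = of_bool (x = y)"
    and p_add: "0 \<le> s \<Longrightarrow> 0 \<le> t \<Longrightarrow> (\<lambda>z. p s x z * p t z y) sums p (s + t) x y"
    and p_deriv: "((\<lambda>t. (p t x y - of_bool (x = y)) / t) \<longlongrightarrow>
      bd_generator lam nu (\<lambda>z. of_bool (z = y)) x) (at_right 0)"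
begin

section \<open>Lower bounds for the entries of the transition function\<close>

lemma p_sum_le_one: "0 \<le> t \<Longrightarrow> finite F \<Longrightarrow> sum (p t x) F \<le> 1"
  using sum_le_suminf[OF sums_summable[OF p_sums[of t x]], of F] p_nonneg[of t x] sums_unique[OF p_sums[of t x]]
  by auto

lemma p_le_one: "0 \<le> t \<Longrightarrow> p t x y \<le> 1"
  using p_sum_le_one[of t "{y}" x] by simp

lemma p_add_ge_sum:
  assumes "0 \<le> s" "0 \<le> t" "finite F"
  shows "(\<Sum>z\<in>F. p s x z * p t z y) \<le> p (s + t) x y"
  using sum_le_suminf[OF sums_summable[OF p_add[of s t x y]], of F] p_nonneg[of s] p_nonneg[of t]
    sums_unique[OF p_add[of s t x y]] assms
  by auto

lemma p_deriv_seq: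
  assumes "h > 0"
  shows "(\<lambda>n. real n * (p (h / real n) x y - of_bool (x = y)))
    \<longlonglongrightarrow> h * bd_generator lam nu (\<lambda>z. of_bool (z = y)) x"
proof -
  have "filterlim (\<lambda>n. h / real n) (at_right 0) sequentially"
  proof (rule tendsto_imp_filterlim_at_right)
    show "(\<lambda>n. h / real n) \<longlonglongrightarrow> 0" by (rule lim_const_over_n)
    show "\<forall>\<^sub>F n in sequentially. h / real n > 0"
      using eventually_gt_at_top[of 0] by eventually_elim (use assms in auto)
  qed
  from tendsto_mult[OF tendsto_const[of h] filterlim_compose[OF p_deriv this]]
  have "(\<lambda>n. h * ((p (h / real n) x y - of_bool (x = y)) / (h / real n)))
    \<longlonglongrightarrow> h * bd_generator lam nu (\<lambda>z. of_bool (z = y)) x" .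
  then show ?thesis
    by (rule Lim_transform_eventually)
      (use eventually_gt_at_top[of 0] in eventually_elim, use assms in auto)
qed

text \<open>Since \<open>p s x x * p t x x \<le> p (s + t) x x\<close>, the quantity
  \<open>1 - p t x x\<close> is subadditive in \<open>t\<close>. Its value at \<open>h\<close> is
  thus at most \<open>n\<close> times its value at \<open>h / n\<close>, which tends to
  \<open>h\<close> times the exit rate.\<close>

lemma p_diag_ge:
  assumes h: "0 \<le> h"
  shows "1 - h * (lam x + nu x) \<le> p h x x"
proof (cases "h = 0")
  case True
  then show ?thesis by (simp add: p_zero)
next
  case False
  then have h: "h > 0" using h by simp
  have add: "1 - p (s + t) x x \<le> (1 - p s x x) + (1 - p t x x)" if "0 \<le> s" "0 \<le> t" for s t
  proof -
    have "p s x x * p t x x \<le> p (s + t) x x"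
      using p_add_ge_sum[OF that, of "{x}" x x] by simp
    moreover have "0 \<le> (1 - p s x x) * (1 - p t x x)"
      using p_le_one that by (intro mult_nonneg_nonneg) auto
    ultimately show ?thesis by (simp add: algebra_simps)
  qed
  have mult: "1 - p (real k * s) x x \<le> real k * (1 - p s x x)" if "0 \<le> s" for k s
  proof (induction k)
    case (Suc k)
    show ?case using add[of s "real k * s"] Suc that by (simp add: algebra_simps)
  qed (simp add: p_zero)
  have "p h x x - 1 \<ge> h * bd_generator lam nu (\<lambda>z. of_bool (z = x)) x"
  proof (rule LIMSEQ_le_const2[OF p_deriv_seq[OF h]], intro exI[of _ 1] allI impI)
    fix n :: nat assume "1 \<le> n"
    then show "real n * (p (h / real n) x x - of_bool (x = x)) \<le> p h x x - 1"
      using mult[of "h / real n" n] h by (simp add: algebra_simps)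
  qed
  moreover have "bd_generator lam nu (\<lambda>z. of_bool (z = x)) x = - (lam x + nu x)"
    using nu_zero by (cases x) (auto simp: bd_generator_def)
  ultimately show ?thesis by (simp add: algebra_simps)
qed

lemma p_diag_ge': "0 \<le> h \<Longrightarrow> 1 - h * C \<le> p h x x"
  using p_diag_ge[of h x] mult_left_mono[OF rates_le[of x], of h] by linarith

text \<open>Cut \<open>h\<close> into \<open>n\<close> steps of length \<open>s\<close>. Each step
  gains the jump from \<open>x\<close> to \<open>y\<close>, with the chain at \<open>x\<close> with
  probability at least \<open>1 - h * C\<close>, and loses at most \<open>h * C * (s * C)\<close> by
  leaving \<open>y\<close>. The limit of the sum is
  \<open>(1 - h * C) * (h * g) - (h * C)\<^sup>2\<close>.\<close>

lemma p_offdiag_ge: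
  assumes h: "h > 0" and xy: "x \<noteq> y"
    and g: "g = bd_generator lam nu (\<lambda>z. of_bool (z = y)) x" "0 \<le> g" "g \<le> C"
  shows "h * g - 2 * (h * C)\<^sup>2 \<le> p h x y"
proof (cases "h * C \<le> 1")
  case hC: True
  have fin: "real n * (1 - h * C) * p (h / real n) x y - (h * C)\<^sup>2 \<le> p h x y" if n: "1 \<le> n" for n
  proof -
    define s where "s = h / real n"
    have s: "0 \<le> s" "s * real n = h" using h n by (auto simp: s_def)
    have "real k * ((1 - h * C) * p s x y - h * C * (s * C)) \<le> p (real k * s) x y" if "k \<le> n" for k
      using that
    proof (induction k)
      case 0
      then show ?case by (simp add: p_zero)
    next
      case (Suc k)
      have ks: "0 \<le> real k * s" "real k * s \<le> h"
        using s Suc.prems mult_left_mono[of "real k" "real n" s] by (auto simp: mult.commute)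
      have d: "1 - h * C \<le> p (real k * s) x x"
        using p_diag_ge'[OF ks(1), of x] mult_right_mono[OF ks(2) C_nonneg] by linarith
      have o: "p (real k * s) x y \<le> h * C"
      proof -
        have "p (real k * s) x x + p (real k * s) x y \<le> 1"
          using p_sum_le_one[OF ks(1), of "{x, y}" x] xy by simp
        with d show ?thesis by linarith
      qed
      have "(1 - h * C) * p s x y \<le> p (real k * s) x x * p s x y"
        using d p_nonneg[OF s(1)] by (intro mult_right_mono) auto
      moreover have "p (real k * s) x y * (1 - s * C) \<le> p (real k * s) x y * p s y y"
        using p_diag_ge'[OF s(1)] p_nonneg[OF ks(1)] by (intro mult_left_mono) auto
      moreover have "p (real k * s) x y * (s * C) \<le> h * C * (s * C)"
        using o s C_nonneg by (intro mult_right_mono) auto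
      moreover have "p (real k * s) x x * p s x y + p (real k * s) x y * p s y y \<le> p (real (Suc k) * s) x y"
        using p_add_ge_sum[OF ks(1) s(1), of "{x, y}" x y] xy by (simp add: algebra_simps)
      ultimately show ?case
        using Suc by (simp add: algebra_simps)
    qed
    from this[of n] have "real n * ((1 - h * C) * p s x y - h * C * (s * C)) \<le> p h x y"
      using s(2) by (simp add: mult.commute)
    moreover have "real n * ((1 - h * C) * p s x y - h * C * (s * C))
        = real n * (1 - h * C) * p s x y - h * C * ((s * real n) * C)"
      by (simp add: algebra_simps)
    ultimately show ?thesis
      unfolding s(2) s_def[symmetric] by (simp add: power2_eq_square)
  qed
  have "(1 - h * C) * (h * g) - (h * C)\<^sup>2 \<le> p h x y"
  proof (rule LIMSEQ_le_const2)
    show "(\<lambda>n. (1 - h * C) * (real n * (p (h / real n) x y - of_bool (x = y))) - (h * C)\<^sup>2)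
      \<longlonglongrightarrow> (1 - h * C) * (h * g) - (h * C)\<^sup>2"
      unfolding g by (intro tendsto_intros p_deriv_seq h)
    show "\<exists>N. \<forall>n\<ge>N. (1 - h * C) * (real n * (p (h / real n) x y - of_bool (x = y))) - (h * C)\<^sup>2 \<le> p h x y"
      using fin xy by (intro exI[of _ 1]) (auto simp: algebra_simps)
  qed
  moreover have "h * C * (h * g) \<le> h * C * (h * C)"
    using h g C_nonneg by (intro mult_left_mono) auto
  ultimately show ?thesis by (simp add: algebra_simps power2_eq_square)
next
  case False
  \<comment> \<open>For \<open>h * C > 1\<close> the claimed lower bound is not positive.\<close>
  then have "h * C \<le> (h * C)\<^sup>2"
    using h C_nonneg by (simp add: power2_eq_square mult_le_cancel_left1)
  moreover have "h * g \<le> h * C" using g h by simp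
  moreover have "0 \<le> p h x y" using h by (simp add: p_nonneg)
  ultimately show ?thesis using zero_le_power2[of "h * C"] by linarith
qed

lemma p_up_ge: "h > 0 \<Longrightarrow> h * lam x - 2 * (h * C)\<^sup>2 \<le> p h x (x + 1)"
  using rates_le[of x] lam_nonneg[of x] nu_nonneg[of x]
  by (intro p_offdiag_ge) (auto simp: bd_generator_def)

lemma p_down_ge: "h > 0 \<Longrightarrow> x > 0 \<Longrightarrow> h * nu x - 2 * (h * C)\<^sup>2 \<le> p h x (x - 1)"
  using rates_le[of x] lam_nonneg[of x] nu_nonneg[of x]
  by (intro p_offdiag_ge) (auto simp: bd_generator_def)

lemma p_summable:
  assumes "0 \<le> t" "\<And>z. \<bar>u z\<bar> \<le> 1"
  shows "summable (\<lambda>z. p t x z * u z)"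
proof (rule summable_comparison_test'[OF sums_summable[OF p_sums[OF assms(1)]]])
  show "norm (p t x z * u z) \<le> p t x z" for z
    using mult_left_mono[OF assms(2) p_nonneg[OF assms(1)]] p_nonneg[OF assms(1)] by (simp add: abs_mult)
qed

text \<open>Keep only \<open>x\<close> and its neighbours in the sum. Since
  \<open>u \<le> 1\<close>, each of the at most two off-diagonal entries costs at most
  \<open>2 * (h * C)\<^sup>2\<close>, hence the constant 4.\<close>

lemma bd_step_le_p:
  assumes h: "h > 0" and u: "\<And>z. 0 \<le> u z" "\<And>z. u z \<le> 1"
  shows "bd_step lam nu h u x - 4 * (h * C)\<^sup>2 \<le> (\<Sum>z. p h x z * u z)"
proof -
  have le: "(\<Sum>z\<in>F. p h x z * u z) \<le> (\<Sum>z. p h x z * u z)" if "finite F" for F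
    using h u by (intro sum_le_suminf p_summable that mult_nonneg_nonneg p_nonneg) auto
  have c: "(a - e) * v \<le> b * v \<Longrightarrow> 0 \<le> e \<Longrightarrow> v \<le> 1 \<Longrightarrow> a * v - e \<le> b * v" for a b e v :: real
    using mult_left_mono[of v 1 e] by (simp add: algebra_simps)
  have e: "0 \<le> 2 * (h * C)\<^sup>2" by simp
  have d: "(1 - h * (lam x + nu x)) * u x \<le> p h x x * u x"
    using p_diag_ge[of h x] h u by (intro mult_right_mono) auto
  have up: "h * lam x * u (x + 1) - 2 * (h * C)\<^sup>2 \<le> p h x (x + 1) * u (x + 1)"
    by (rule c[OF mult_right_mono[OF p_up_ge[OF h] u(1)] e u(2)])
  show ?thesis
  proof (cases x)
    case 0
    then have "bd_step lam nu h u x = (1 - h * (lam x + nu x)) * u x + h * lam x * u (x + 1)"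
      by (simp add: bd_step_eq nu_zero)
    moreover have "p h x x * u x + p h x (x + 1) * u (x + 1) \<le> (\<Sum>z. p h x z * u z)"
      using le[of "{x, x + 1}"] by simp
    ultimately show ?thesis
      using d up e by linarith
  next
    case (Suc m)
    then have down: "h * nu x * u (x - 1) - 2 * (h * C)\<^sup>2 \<le> p h x (x - 1) * u (x - 1)"
      by (intro c[OF mult_right_mono[OF p_down_ge[OF h] u(1)] e u(2)]) simp
    show ?thesis
      using d up down le[of "{x - 1, x, x + 1}"] Suc by (simp add: bd_step_eq)
  qed
qed

text \<open>Both kernels have mass one, so the lower bound applied to \<open>1 - u\<close> is the upper bound.\<close>

lemma abs_p_minus_bd_step_le:
  assumes h: "h > 0" and u: "\<And>z. 0 \<le> u z" "\<And>z. u z \<le> 1"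
  shows "\<bar>(\<Sum>z. p h x z * u z) - bd_step lam nu h u x\<bar> \<le> 4 * (h * C)\<^sup>2"
proof -
  have p: "p h x sums 1" using h by (simp add: p_sums)
  have "summable (\<lambda>z. p h x z * u z)" using h u by (intro p_summable) auto
  from sums_unique[OF sums_diff[OF p summable_sums[OF this]]]
  have "(\<Sum>z. p h x z * (1 - u z)) = 1 - (\<Sum>z. p h x z * u z)"
    by (simp add: algebra_simps)
  moreover have "bd_step lam nu h (\<lambda>z. 1 - u z) x = 1 - bd_step lam nu h u x"
    by (simp add: bd_step_diff bd_step_const)
  ultimately show ?thesis
    using bd_step_le_p[of h u x] bd_step_le_p[of h "\<lambda>z. 1 - u z" x] h u by (simp add: abs_le_iff)
qed

text \<open>Local errors accumulate additively: with \<open>P\<close> the semigroup and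
  \<open>S\<close> the Euler step, \<open>P (k * h + h) - S ^ (k + 1)\<close> splits into
  \<open>(P h - S)\<close> applied to \<open>P (k * h)\<close> and \<open>S\<close> applied to
  \<open>P (k * h) - S ^ k\<close>, and \<open>S\<close> contracts the supremum norm.\<close>

lemma abs_p_minus_bd_step_funpow_le:
  assumes h: "h > 0" "h * C \<le> 1"
  shows "\<bar>p (real k * h) x w - (bd_step lam nu h ^^ k) (\<lambda>z. of_bool (z = w)) x\<bar> \<le> real k * (4 * (h * C)\<^sup>2)"
proof (induction k arbitrary: x)
  case 0
  then show ?case by (simp add: p_zero)
next
  case (Suc k)
  let ?u = "\<lambda>z. p (real k * h) z w"
  let ?v = "(bd_step lam nu h ^^ k) (\<lambda>z. of_bool (z = w))"
  have "p (real (Suc k) * h) x w = (\<Sum>z. p h x z * ?u z)"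
    using sums_unique[OF p_add[of h "real k * h" x w]] h by (simp add: algebra_simps)
  moreover have "\<bar>(\<Sum>z. p h x z * ?u z) - bd_step lam nu h ?u x\<bar> \<le> 4 * (h * C)\<^sup>2"
    using h by (intro abs_p_minus_bd_step_le p_nonneg p_le_one) auto
  moreover have "\<bar>bd_step lam nu h ?u x - bd_step lam nu h ?v x\<bar> \<le> real k * (4 * (h * C)\<^sup>2)"
    unfolding bd_step_diff[symmetric] using h by (intro bd_step_abs_le Suc.IH) auto
  ultimately have "\<bar>p (real (Suc k) * h) x w - bd_step lam nu h ?v x\<bar>
      \<le> 4 * (h * C)\<^sup>2 + real k * (4 * (h * C)\<^sup>2)"
    by linarith
  then show ?case by (simp add: algebra_simps)
qed

section \<open>Convergence of the Euler iterates and the deviation bound for the semigroup\<close>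

lemma eventually_step_small: "\<forall>\<^sub>F n in sequentially. n > 0 \<and> c * (t / real n) * C \<le> 1"
proof -
  have "(\<lambda>n. c * t * C / real n) \<longlonglongrightarrow> 0" by (rule lim_const_over_n)
  then have "\<forall>\<^sub>F n in sequentially. c * t * C / real n < 1"
    by (rule order_tendstoD) simp
  with eventually_gt_at_top[of 0] show ?thesis
    by eventually_elim (auto simp: field_simps)
qed

lemma bd_step_funpow_tendsto_p:
  assumes t: "t > 0"
  shows "(\<lambda>n. (bd_step lam nu (t / real n) ^^ n) (\<lambda>z. of_bool (z = w)) x) \<longlonglongrightarrow> p t x w"
proof (rule LIM_zero_cancel, rule Lim_null_comparison)
  show "(\<lambda>n. 4 * (t * C)\<^sup>2 / real n) \<longlonglongrightarrow> 0" by (rule lim_const_over_n)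
  show "\<forall>\<^sub>F n in sequentially.
    norm ((bd_step lam nu (t / real n) ^^ n) (\<lambda>z. of_bool (z = w)) x - p t x w) \<le> 4 * (t * C)\<^sup>2 / real n"
    using eventually_step_small[of 1 t]
  proof eventually_elim
    case (elim n)
    have "\<bar>p t x w - (bd_step lam nu (t / real n) ^^ n) (\<lambda>z. of_bool (z = w)) x\<bar>
      \<le> real n * (4 * (t / real n * C)\<^sup>2)"
    proof -
      have h: "t / real n > 0" "t / real n * C \<le> 1" using elim t by auto
      have "real n * (t / real n) = t" using elim by simp
      with abs_p_minus_bd_step_funpow_le[OF h, of n x w] show ?thesis by (simp only:)
    qed
    also have "\<dots> = 4 * (t * C)\<^sup>2 / real n"
      using elim by (simp add: field_simps power2_eq_square)
    finally show ?case by (simp add: abs_minus_commute)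
  qed
qed

text \<open>Dominated convergence for series (Tannery): the kernel entries converge, and linear
  growth of \<open>g\<close> against the uniform geometric tails gives a summable majorant.\<close>

lemma bd_step_funpow_tendsto:
  assumes t: "t > 0" and g: "\<And>w. \<bar>g w\<bar> \<le> a + b * real w"
  shows "summable (\<lambda>w. \<bar>g w * p t x w\<bar>)"
    and "(\<lambda>n. (bd_step lam nu (t / real n) ^^ n) g x) \<longlonglongrightarrow> (\<Sum>w. g w * p t x w)"
proof -
  let ?q = "\<lambda>n w. (bd_step lam nu (t / real n) ^^ n) (\<lambda>z. of_bool (z = w)) x"
  let ?M = "\<lambda>w. (a + b * real w) * (exp (t * C) * 2 ^ x / 2 ^ w)"
  have s: "summable (\<lambda>w. (1/2) ^ w :: real)" by (rule summable_geometric) simp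
  have "summable (\<lambda>w. real (Suc w) * (1/2) ^ w)"
    by (rule sums_summable[OF geometric_deriv_sums]) simp
  \<comment> \<open>Subtracting the geometric series from its derivative leaves the series with
    coefficients \<open>real w\<close>.\<close>
  from summable_diff[OF this s] have "summable (\<lambda>w. real w * (1/2) ^ w)"
    by (simp add: algebra_simps)
  with s have "summable (\<lambda>w. exp (t * C) * 2 ^ x * (a * (1/2) ^ w + b * (real w * (1/2) ^ w)))"
    by (intro summable_mult summable_add)
  then have M: "summable ?M"
    by (simp add: field_simps power_divide)
  have "\<forall>\<^sub>F n in sequentially. \<forall>w. norm (g w * ?q n w) \<le> ?M w"
    using eventually_step_small[of 1 t]
  proof eventually_elim
    case (elim n)
    show ?case
    proof
      fix w
      have "0 \<le> ?q n w" "?q n w \<le> exp (t * C) * 2 ^ x / 2 ^ w"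
        using bd_step_funpow_indicator_bounds[of "t / real n" n w x] elim t by auto
      then show "norm (g w * ?q n w) \<le> ?M w"
        unfolding norm_mult using g[of w] by (intro mult_mono) auto
    qed
  qed
  then have "\<forall>\<^sub>F (w, n) in at_top \<times>\<^sub>F sequentially. norm (g w * ?q n w) \<le> ?M w"
    by (rule eventually_mono[OF eventually_prodI[OF eventually_True[of at_top]]]) auto
  from tannerys_theorem[OF tendsto_mult_left[OF bd_step_funpow_tendsto_p[OF t]] this M]
  have *: "summable (\<lambda>w. norm (g w * p t x w))"
    "(\<lambda>n. \<Sum>w. g w * ?q n w) \<longlonglongrightarrow> (\<Sum>w. g w * p t x w)"
    by simp_all
  show "summable (\<lambda>w. \<bar>g w * p t x w\<bar>)" using *(1) by simp
  show "(\<lambda>n. (bd_step lam nu (t / real n) ^^ n) g x) \<longlonglongrightarrow> (\<Sum>w. g w * p t x w)"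
    using *(2) unfolding sums_unique[OF bd_step_funpow_sums, symmetric] .
qed

text \<open>The Chernoff bound is proved for the Euler chain, where all sums are finite, but with
  the threshold \<open>m + y\<close> of the limit; then \<open>n\<close> tends to infinity and the
  Euler mean of \<open>f\<close> tends to \<open>m\<close>.\<close>

theorem p_deviation_le:
  assumes C: "C > 0" and L: "L > 0" "\<And>x. \<bar>f (x + 1) - f x\<bar> \<le> L"
    and K: "K \<le> 0" "\<And>x. K \<le> lam x - lam (x + 1) + nu (x + 1) - nu x"
    and t: "t > 0" and y: "y > 0"
  shows "(\<Sum>w. of_bool (y \<le> f w - (\<Sum>z. f z * p t x z)) * p t x w)
    \<le> exp (- (y * exp (t * K) / (2 * L)) * ln (1 + y * sinh_ratio K t / (C * L)))"
proof -
  define m where "m = (\<Sum>z. f z * p t x z)"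
  \<comment> \<open>\<open>M\<close> bounds the Lipschitz constant at time \<open>t\<close>,
    \<open>V\<close> is \<open>C\<close> times the integral bounding the Riemann sums,
    \<open>r = y / (V * M)\<close>, and \<open>\<tau>\<close> is the optimal exponent, with
    \<open>b = \<tau> * M\<close>.\<close>
  define M where "M = L * exp (- t * K)"
  define r where "r = y * sinh_ratio K t / (C * L)"
  define V where "V = C * (exp (t * K) / sinh_ratio K t)"
  define b where "b = ln (1 + r)"
  define \<tau> where "\<tau> = b / M"
  have r: "r > 0" unfolding r_def using C L y sinh_ratio_pos[OF t] by simp
  have M: "M > 0" using L by (simp add: M_def)
  have b: "b > 0" unfolding b_def using r by simp
  have \<tau>: "\<tau> > 0" unfolding \<tau>_def using b M by simp
  have y_eq: "y = V * M * r"
    using C L sinh_ratio_pos[OF t, of K] by (simp add: V_def M_def r_def exp_minus)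
  note f = abs_le_of_increments_le[of f, OF L(2)]
  let ?S = "\<lambda>n. bd_step lam nu (t / real n) ^^ n"
  let ?ind = "\<lambda>w. of_bool (y \<le> f w - m) :: real"
  have "(\<Sum>w. ?ind w * p t x w) \<le> exp (\<tau> * m + V * (exp b - 1 - b) - \<tau> * (m + y))"
  proof (rule tendsto_le[OF sequentially_bot])
    show "(\<lambda>n. ?S n ?ind x) \<longlonglongrightarrow> (\<Sum>w. ?ind w * p t x w)"
      by (rule bd_step_funpow_tendsto(2)[OF t, of _ 1 0]) auto
    show "(\<lambda>n. exp (\<tau> * ?S n f x + V * (exp b - 1 - b) - \<tau> * (m + y)))
        \<longlonglongrightarrow> exp (\<tau> * m + V * (exp b - 1 - b) - \<tau> * (m + y))"
      unfolding m_def by (intro tendsto_intros bd_step_funpow_tendsto(2)[OF t f])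
    show "\<forall>\<^sub>F n in sequentially. ?S n ?ind x \<le> exp (\<tau> * ?S n f x + V * (exp b - 1 - b) - \<tau> * (m + y))"
      using eventually_step_small[of 2 t]
    proof eventually_elim
      case (elim n)
      let ?h = "t / real n"
      have h: "0 \<le> ?h" "2 * ?h * C \<le> 1" "?h * real n = t" using elim t by auto
      have hC: "?h * C \<le> 1" using h mult_nonneg_nonneg[OF h(1) C_nonneg] by linarith
      \<comment> \<open>Exponential Markov inequality, pointwise.\<close>
      have "?ind w \<le> exp (- \<tau> * (m + y)) * exp (\<tau> * f w)" for w
      proof (cases "y \<le> f w - m")
        case True
        then have "\<tau> * (m + y) \<le> \<tau> * f w" using \<tau> by (intro mult_left_mono) auto
        then show ?thesis using True by (simp add: exp_add[symmetric])
      qed simp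
      then have "?S n ?ind x \<le> ?S n (\<lambda>w. exp (- \<tau> * (m + y)) * exp (\<tau> * f w)) x"
        by (intro bd_step_funpow_mono h hC)
      also have "\<dots> = exp (- \<tau> * (m + y)) * ?S n (\<lambda>w. exp (\<tau> * f w)) x"
        by (simp only: bd_step_funpow_scale)
      also have "?S n (\<lambda>w. exp (\<tau> * f w)) x \<le> exp (?S n (\<lambda>w. \<tau> * f w) x
          + C * (?h * (\<Sum>j<n. (exp (K * (t - ?h * real j)))\<^sup>2)) * (exp b - 1 - b))"
      proof (rule bd_step_funpow_exp_le[OF h K nu_zero])
        fix x
        have "\<bar>\<tau> * f (x + 1) - \<tau> * f x\<bar> = \<tau> * \<bar>f (x + 1) - f x\<bar>"
          using \<tau> by (simp add: abs_mult right_diff_distrib[symmetric])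
        also have "\<dots> \<le> \<tau> * L" using L \<tau> by (intro mult_left_mono) auto
        also have "\<dots> = exp (K * t) * b"
          using L by (simp add: \<tau>_def M_def exp_minus field_simps)
        finally show "\<bar>\<tau> * f (x + 1) - \<tau> * f x\<bar> \<le> exp (K * t) * b" .
      qed (use b in auto)
      also have "\<dots> \<le> exp (\<tau> * ?S n f x + V * (exp b - 1 - b))"
      proof -
        have "C * (?h * (\<Sum>j<n. (exp (K * (t - ?h * real j)))\<^sup>2)) \<le> V"
          unfolding V_def using C by (intro mult_left_mono riemann_sum_exp_le K h t) auto
        then have "C * (?h * (\<Sum>j<n. (exp (K * (t - ?h * real j)))\<^sup>2)) * (exp b - 1 - b) \<le> V * (exp b - 1 - b)"
          by (rule mult_right_mono) (use exp_ge_add_one_self[of b] in linarith)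
        then show ?thesis by (simp add: bd_step_funpow_scale)
      qed
      finally show ?case
        by (simp add: exp_add[symmetric] algebra_simps)
    qed
  qed
  also have "\<tau> * m + V * (exp b - 1 - b) - \<tau> * (m + y) = - (b / M) * y + V * (exp b - 1 - b)"
    by (simp add: \<tau>_def algebra_simps add_divide_distrib)
  also have "exp \<dots> \<le> exp (- (y / (2 * M)) * b)"
    using optimal_exponent_bound[OF M y r y_eq] by (simp add: b_def)
  also have "y / (2 * M) = y * exp (t * K) / (2 * L)"
    by (simp add: M_def exp_minus field_simps)
  finally show ?thesis by (simp add: b_def r_def m_def)
qed

end

subsection \<open>The transition function of the process\<close>

context markov_process
begin

text \<open>With \<open>A\<close> the whole space this yields total mass one; with \<open>A\<close>
  an event at time \<open>s + t\<close> it yields the Chapman-Kolmogorov equation.\<close>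

lemma level_set_sums:
  assumes t: "0 \<le> t" and A: "A \<in> sets (P x)"
  shows "(\<lambda>y. measure (P x) (A \<inter> {w \<in> space (P x). X t w = y})) sums measure (P x) A"
proof -
  interpret prob_space "P x" by (rule prob_space_P)
  have [measurable]: "X t \<in> measurable (P x) (count_space UNIV)" by (rule measurable_X[OF t])
  have "(\<lambda>y. measure (P x) (A \<inter> {w \<in> space (P x). X t w = y}))
    sums measure (P x) (\<Union>y. A \<inter> {w \<in> space (P x). X t w = y})"
    by (rule finite_measure_UNION) (use A in \<open>auto simp: disjoint_family_on_def\<close>)
  also have "(\<Union>y. A \<inter> {w \<in> space (P x). X t w = y}) = A"
    using sets.sets_into_space[OF A] by auto
  finally show ?thesis .
qed

lemma transition_prob_nonneg: "0 \<le> transition_prob P X t x y"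
  by (simp add: transition_prob_def)

lemma transition_prob_sums: "0 \<le> t \<Longrightarrow> transition_prob P X t x sums 1"
  using level_set_sums[of t "space (P x)" x] prob_space.prob_space[OF prob_space_P[of x]]
  by (simp add: transition_prob_def[abs_def] Int_absorb1)

lemma transition_prob_zero: "transition_prob P X 0 x y = of_bool (x = y)"
proof -
  interpret prob_space "P x" by (rule prob_space_P)
  have [measurable]: "X 0 \<in> measurable (P x) (count_space UNIV)" by (rule measurable_X) simp
  have "AE w in P x. (X 0 w = y) = (x = y)"
    using start[of x] by eventually_elim auto
  then have "measure (P x) {w \<in> space (P x). X 0 w = y} = measure (P x) {w \<in> space (P x). x = y}"
    by (intro finite_measure_eq_AE) auto
  then show ?thesis using prob_space by (cases "x = y") (auto simp: transition_prob_def)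
qed

lemma transition_prob_add:
  assumes s: "0 \<le> s" and t: "0 \<le> t"
  shows "(\<lambda>z. transition_prob P X s x z * transition_prob P X t z y) sums transition_prob P X (s + t) x y"
proof -
  have st: "0 \<le> s + t" using s t by simp
  have [measurable]: "X (s + t) \<in> measurable (P x) (count_space UNIV)" by (rule measurable_X[OF st])
  let ?A = "{w \<in> space (P x). X (s + t) w = y}"
  \<comment> \<open>The Markov property with the trivial past event.\<close>
  have "space (P x) \<in> past_events (space (P x)) X s"
    unfolding past_events_def by (rule sigma_sets_top)
  note mp = markov_property[OF s t this]
  have "measure (P x) (?A \<inter> {w \<in> space (P x). X s w = z})
      = transition_prob P X s x z * transition_prob P X t z y" for z
  proof -
    have "?A \<inter> {w \<in> space (P x). X s w = z}
        = space (P x) \<inter> {w \<in> space (P x). X s w = z \<and> X (s + t) w = y}"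
      "space (P x) \<inter> {w \<in> space (P x). X s w = z} = {w \<in> space (P x). X s w = z}"
      by auto
    then show ?thesis using mp[of z y] by (simp add: transition_prob_def[of P X s])
  qed
  then show ?thesis
    using level_set_sums[OF s, of ?A x] by (simp add: transition_prob_def[of P X "s + t"])
qed

text \<open>The law of \<open>X t\<close> has density \<open>transition_prob P X t x\<close> with
  respect to counting measure.\<close>

lemma integral_transition_prob:
  assumes t: "0 \<le> t" and g: "summable (\<lambda>y. \<bar>g y * transition_prob P X t x y\<bar>)"
  shows "(\<integral>w. g (X t w) \<partial>P x) = (\<Sum>y. g y * transition_prob P X t x y)"
proof -
  interpret prob_space "P x" by (rule prob_space_P)
  have X[measurable]: "X t \<in> measurable (P x) (count_space UNIV)" by (rule measurable_X[OF t])
  let ?p = "transition_prob P X t x"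
  have "distr (P x) (count_space UNIV) (X t) = density (count_space UNIV) (\<lambda>y. ennreal (?p y))"
  proof (rule measure_eqI_countable[of _ UNIV])
    fix a
    have "X t -` {a} \<inter> space (P x) = {w \<in> space (P x). X t w = a}" by auto
    then have "emeasure (distr (P x) (count_space UNIV) (X t)) {a} = ennreal (?p a)"
      by (simp add: emeasure_distr emeasure_eq_measure transition_prob_def)
    also have "\<dots> = emeasure (density (count_space UNIV) (\<lambda>y. ennreal (?p y))) {a}"
      by (simp add: emeasure_density)
    finally show "emeasure (distr (P x) (count_space UNIV) (X t)) {a}
      = emeasure (density (count_space UNIV) (\<lambda>y. ennreal (?p y))) {a}" .
  qed auto
  then have "(\<integral>w. g (X t w) \<partial>P x) = (\<integral>y. g y \<partial>density (count_space UNIV) (\<lambda>y. ennreal (?p y)))"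
    by (simp flip: integral_distr[OF X])
  also have "\<dots> = (\<integral>y. g y * ?p y \<partial>count_space UNIV)"
    by (subst integral_density) (auto simp: transition_prob_nonneg mult.commute)
  also have "\<dots> = (\<Sum>y. g y * ?p y)"
    by (rule integral_count_space_nat) (use g in \<open>simp add: integrable_count_space_nat_iff\<close>)
  finally show ?thesis .
qed

end

section \<open>Pointwise forms of the hypotheses on generator, rates and \<open>f\<close>\<close>

lemma has_bd_generator_indicator:
  assumes "has_bd_generator p lam nu"
  shows "((\<lambda>t. (p t x y - of_bool (x = y)) / t) \<longlongrightarrow>
    bd_generator lam nu (\<lambda>z. of_bool (z = y)) x) (at_right 0)"
proof -
  have "(\<Sum>z. p t x z * of_bool (z = y)) = p t x y" for t
    by (subst suminf_finite[of "{y}"]) auto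
  then show ?thesis
    using assms[unfolded has_bd_generator_def, rule_format, of "\<lambda>z. of_bool (z = y)" x] by simp
qed

lemma Lip_norm_ge_diff:
  assumes "is_Lip f"
  shows "\<bar>f (x + 1) - f x\<bar> \<le> Lip_norm f"
  unfolding Lip_norm_def
proof (rule cSup_upper)
  show "\<bar>f (x + 1) - f x\<bar> \<in> lip_quotients f"
    unfolding lip_quotients_def by (intro CollectI exI[of _ "x + 1"] exI[of _ x]) (simp add: dist_real_def)
qed (use assms in \<open>simp add: is_Lip_def\<close>)

text \<open>Boundedness of the rates is what makes the real-valued supremum a genuine upper
  bound.\<close>

lemma bounded_rates_le_rate_sup_norm:
  assumes "bounded (range lam)" "bounded (range nu)"
  shows "lam x + nu x \<le> rate_sup_norm lam nu"
  unfolding rate_sup_norm_def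
proof (rule cSUP_upper)
  from assms obtain a b where "\<bar>lam x\<bar> \<le> a" "\<bar>nu x\<bar> \<le> b" for x
    by (auto simp: bounded_iff)
  then show "bdd_above (range (\<lambda>x. lam x + nu x))"
    by (intro bdd_aboveI[of _ "a + b"]) (auto intro!: add_mono simp: abs_le_iff)
qed simp

lemma bounded_rates_INF_le:
  fixes lam nu :: "nat \<Rightarrow> real"
  assumes "bounded (range lam)" "bounded (range nu)"
  shows "(INF z\<in>UNIV - {0}. lam (z - 1) - lam z + nu z - nu (z - 1))
    \<le> lam x - lam (x + 1) + nu (x + 1) - nu x"
proof -
  from assms obtain a b where ab: "\<bar>lam x\<bar> \<le> a" "\<bar>nu x\<bar> \<le> b" for x
    by (auto simp: bounded_iff)
  have "bdd_below ((\<lambda>z. lam (z - 1) - lam z + nu z - nu (z - 1)) ` (UNIV - {0}))"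
  proof (intro bdd_belowI2)
    show "- 2 * a - 2 * b \<le> lam (z - 1) - lam z + nu z - nu (z - 1)" for z
      using ab[of z] ab[of "z - 1"] by linarith
  qed
  \<comment> \<open>The infimum runs over right endpoints \<open>z\<close> of edges, hence the shift
    \<open>z = x + 1\<close>.\<close>
  from cINF_lower[OF this, of "Suc x"] show ?thesis by simp
qed

section \<open>The deviation inequality for the process\<close>

theorem corollary4p6:
  fixes P :: "nat \<Rightarrow> 'w measure"
    and X :: "real \<Rightarrow> 'w \<Rightarrow> nat"
    and lam nu f :: "nat \<Rightarrow> real"
    and \<pi> :: "nat pmf"
    and K t y :: real
    and x :: nat
  assumes "birth_death_process P X lam nu"
    and "regular_rates lam nu"
    and "nonexplosive P X"
    and "stationary_distribution P X \<pi>"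
    and "finite_first_moment \<pi>"
    and "bounded (range lam)"
    and "bounded (range nu)"
    and "K \<le> 0"
    and "(INF z\<in>UNIV - {0}. lam (z - 1) - lam z + nu z - nu (z - 1)) \<ge> K"
    and "is_Lip f"
    and "t > 0"
    and "y > 0"
  shows "measure (P x)
           {w \<in> space (P x). f (X t w) - integral\<^sup>L (P x) (\<lambda>w. f (X t w)) \<ge> y}
         \<le> deviation_bound K (rate_sup_norm lam nu) (Lip_norm f) t y"
proof -
  interpret birth_death_process P X lam nu by fact
  let ?p = "transition_prob P X" and ?C = "rate_sup_norm lam nu" and ?L = "Lip_norm f"
  have pos: "lam z > 0" "nu z \<ge> 0" "nu 0 = 0" for z
    using rates by (cases "z = 0"; auto simp: birth_death_rates_def less_imp_le)+
  interpret bounded_bd_semigroup lam nu ?C ?p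
    by unfold_locales
      (rule pos less_imp_le[OF pos(1)] bounded_rates_le_rate_sup_norm[OF assms(6,7)]
        transition_prob_nonneg transition_prob_zero has_bd_generator_indicator[OF generator]
        transition_prob_sums transition_prob_add; assumption?)+
  have C: "?C > 0"
    using bounded_rates_le_rate_sup_norm[OF assms(6,7), of 0] pos(1)[of 0] pos(2)[of 0] by linarith
  have K: "K \<le> lam z - lam (z + 1) + nu (z + 1) - nu z" for z
    using assms(9) bounded_rates_INF_le[OF assms(6,7), of z] by linarith
  note L = Lip_norm_ge_diff[OF assms(10)]
  interpret prob_space "P x" by (rule prob_space_P)
  have t: "0 \<le> t" using assms by simp
  have [measurable]: "X t \<in> measurable (P x) (count_space UNIV)" by (rule measurable_X[OF t])
  let ?E = "\<integral>w. f (X t w) \<partial>P x"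
  show ?thesis
  proof (cases "?L = 0")
    case True
    \<comment> \<open>A zero Lipschitz norm makes \<open>f\<close> constant, so the deviation is
      zero and the event is empty because \<open>y > 0\<close>.\<close>
    have f: "f z = f 0" for z
    proof (induction z)
      case (Suc z)
      then show ?case using L[of z] True by simp
    qed simp
    have 0: "f (X t w) - ?E = 0" for w
    proof -
      have "(\<lambda>w. f (X t w)) = (\<lambda>_. f 0)" by (intro ext f)
      with f[of "X t w"] show ?thesis by (simp add: prob_space)
    qed
    show ?thesis unfolding 0 using True \<open>y > 0\<close> by (simp add: deviation_bound_def)
  next
    case False
    then have L0: "?L > 0" using L[of 0] by linarith
    note f = abs_le_of_increments_le[of f, OF L]
    have E: "?E = (\<Sum>z. f z * ?p t x z)"
      by (rule integral_transition_prob[OF t bd_step_funpow_tendsto(1)[OF assms(11) f]])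
    \<comment> \<open>The probability is an expectation of a bounded function of \<open>X t\<close>,
      so it becomes a series over the transition function.\<close>
    have "measure (P x) {w \<in> space (P x). f (X t w) - ?E \<ge> y}
        = (\<integral>w. indicator {w \<in> space (P x). f (X t w) - ?E \<ge> y} w \<partial>P x)"
      by simp
    also have "\<dots> = (\<integral>w. of_bool (y \<le> f (X t w) - ?E) \<partial>P x)"
      by (intro Bochner_Integration.integral_cong) (auto simp: indicator_def)
    also have "\<dots> = (\<Sum>z. of_bool (y \<le> f z - ?E) * ?p t x z)"
      by (rule integral_transition_prob[OF t bd_step_funpow_tendsto(1)[OF assms(11), of _ 1 0]]) auto
    also have "\<dots> \<le> deviation_bound K ?C ?L t y"
      unfolding E using p_deviation_le[where f = f, OF C L0 L assms(8) K assms(11,12), of x] False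
      by (simp add: deviation_bound_def)
    finally show ?thesis .
  qed
qed

end
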